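(* Let $A(z)$ and $B(z)$ be polynomials in $z$ with complex coefficients, and let $(H_m(z))_{m\ge 0}$ be the sequence of polynomials defined by the generating function $$\sum_{m=0}^{\infty}H_{m}(z)t^{m}=\frac{1}{1+B(z)t+A(z)t^{4}}.$$ Let $\mathcal{C}_4$ be the set of all $z\in\mathbb{C}$ with $A(z)\neq 0$ such that $$\Im\frac{B^{4}(z)}{A(z)}=0\qquad\text{and}\qquad 0\le\Re\frac{B^{4}(z)}{A(z)}\le \frac{4^4}{3^3}.$$ Then for every $m$, each root $z$ of $H_m$ with $A(z)\ne 0$ lies in $\mathcal{C}_4$. Moreover, these roots are dense in $\mathcal{C}_4$ as $m\to\infty$: for every $p\in\mathcal{C}_4$ and every open neighborhood $U$ of $p$ in $\mathbb{C}$, for all sufficiently large $m$ the polynomial $H_m$ has a root $z\in U$ with $A(z)\neq 0$.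
   Context: The generating function identity is one of formal power series in $t$ with coefficients in $\mathbb{C}[z]$. $\Re$ and $\Im$ denote real and imaginary parts. $B^4(z)$ means $(B(z))^4$.
   Formalization: The density claim is proved except when A is not the zero polynomial and B^4 = cA for a constant c in [0, 4^4/3^3]; there it is false, e.g. for A = 1, B = 0, where C_4 is all of the plane but H_{4k} = (-1)^k has no roots. *)

theory Defs
  imports
    Complex_Main
    "HOL-Computational_Algebra.Polynomial"
    "HOL-Computational_Algebra.Formal_Power_Series"
begin

(* The indeterminate of the power series is t and its coefficient ring is complex poly, which
   has no inverse operation; 1 / (1 + B t + A t^4) is therefore expressed as the inverse element
   in the ring of power series. It exists and is unique since the constant term is 1. *)
definition has_genfun4 :: "complex poly \<Rightarrow> complex poly \<Rightarrow> (nat \<Rightarrow> complex poly) \<Rightarrow> bool" where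
  "has_genfun4 A B H \<longleftrightarrow>
     Abs_fps H * (1 + fps_const B * fps_X + fps_const A * fps_X ^ 4) = 1"

definition curve4 :: "complex poly \<Rightarrow> complex poly \<Rightarrow> complex set" where
  "curve4 A B = {z. poly A z \<noteq> 0 \<and>
     Im (poly B z ^ 4 / poly A z) = 0 \<and>
     0 \<le> Re (poly B z ^ 4 / poly A z) \<and>
     Re (poly B z ^ 4 / poly A z) \<le> 4 ^ 4 / 3 ^ 3}"

(* B^4 / A is a constant in the interval [0, 4^4/3^3]. Then curve4 A B is the whole set where A
   does not vanish and density fails: for B = 0 and A = 1, for instance, curve4 A B = UNIV,
   but H (4 * k) = (- 1) ^ k has no roots. *)
definition degenerate4 :: "complex poly \<Rightarrow> complex poly \<Rightarrow> bool" where
  "degenerate4 A B \<longleftrightarrow>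
     A \<noteq> 0 \<and> (\<exists>c::real. 0 \<le> c \<and> c \<le> 4 ^ 4 / 3 ^ 3 \<and> B ^ 4 = smult (complex_of_real c) A)"

end

theory Submission
  imports Defs "HOL-Complex_Analysis.Conformal_Mappings"
begin

text \<open>
  Homogeneity reduces the two polynomials to one real variable: where \<open>b = B z\<close> and
  \<open>a = A z\<close> do not vanish, \<open>H m z\<close> is \<open>(- b) ^ m\<close> times the value at \<open>x = a / b ^ 4\<close> of a
  polynomial \<open>trinom_poly m\<close> whose generating function is \<open>1 / (1 - t + x t ^ 4)\<close>. Its degree is
  at most \<open>m div 4\<close>. Everything rests on finding that many sign changes of it on the ray
  \<open>x \<ge> 27/256\<close>, that is, for \<open>b ^ 4 / a\<close> in \<open>(0, 256/27]\<close>; there is then no room for any other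
  complex root.

  To find them, parametrise \<open>x\<close> by an angle \<open>\<theta> \<in> [0, pi/4)\<close> so that the two roots of smallest
  modulus of \<open>1 - t + x t ^ 4\<close> are complex conjugates with arguments \<open>\<theta>\<close> and \<open>- \<theta>\<close>. Put
  \<open>c = cos \<theta>\<close> and \<open>q = 1 / (4 c\<^sup>2 - 1)\<close>. After rescaling \<open>t\<close> to bring this pair to the unit circle,
  the quartic is
  \<open>(1 - 2 c s + s\<^sup>2) (1 + 2 c q s + q s\<^sup>2) = 1 - 2 c (1 - q) s + q s ^ 4\<close>,
  and \<open>x = q / (2 c (1 - q)) ^ 4\<close> increases with \<open>\<theta>\<close>. The roots of the second factor lie outside
  the unit circle, so the coefficients of the inverse are an oscillation of frequency \<open>\<theta>\<close> plus a
  damped term (\<open>trinomial_recurrence_closed_form\<close>). At the nodes \<open>\<theta> = k pi / (m + 1)\<close> with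
  \<open>1 \<le> k \<le> m / 4\<close> the oscillation has sign \<open>(-1) ^ k\<close> and strictly dominates the damped term,
  however close \<open>\<theta>\<close> is to \<open>pi / 4\<close> (\<open>sign_at_node\<close>). Since the value at \<open>x = 27/256\<close>, the node
  \<open>k = 0\<close>, is positive, this gives \<open>m div 4\<close> sign changes (\<open>trinom_poly_roots\<close>).

  The nodes have spacing \<open>pi / (m + 1)\<close>, so for large \<open>m\<close> any given subinterval of \<open>[0, 256/27]\<close>
  of positive length contains \<open>1 / x\<close> for some root \<open>x\<close> (\<open>trinom_poly_roots_dense\<close>).
  Unless \<open>B ^ 4 / A\<close> is constant, it is an open map near a point \<open>p\<close> of the curve (\<open>quotient_image_open\<close>), so the density of these
  values pulls back to density of the roots near \<open>p\<close>.
\<close>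

section \<open>Reduction to polynomials in one real variable\<close>

text \<open>
  The coefficients in \<open>t\<close> of \<open>1 / (1 - t + x t ^ 4)\<close>, as polynomials in \<open>x\<close>. The coefficient ring is
  left open because sign changes are counted over the reals and roots over the complex numbers.
\<close>

fun trinom_poly :: "nat \<Rightarrow> 'a::comm_ring_1 poly" where
  "trinom_poly n = (if n < 4 then 1 else trinom_poly (n - 1) - [:0, 1:] * trinom_poly (n - 4))"

declare trinom_poly.simps [simp del]

lemma trinom_poly_base: "n < 4 \<Longrightarrow> trinom_poly n = 1"
  by (simp add: trinom_poly.simps)

lemma trinom_poly_step: "trinom_poly (n + 4) = trinom_poly (n + 3) - [:0, 1:] * trinom_poly n"
  by (subst trinom_poly.simps) (simp add: algebra_simps numeral_eq_Suc)

lemma degree_trinom_poly: "degree (trinom_poly n :: 'a::comm_ring_1 poly) \<le> n div 4"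
proof (induction n rule: less_induct)
  case (less n)
  show ?case
  proof (cases "n < 4")
    case False
    then obtain k where n: "n = k + 4" by (metis add.commute le_Suc_ex not_less)
    have "degree (trinom_poly (k + 3) :: 'a poly) \<le> (k + 3) div 4" using less n by auto
    moreover have "(k + 3) div 4 \<le> (k + 4) div 4" by (rule div_le_mono) simp
    moreover have "degree ([:0, 1:] * trinom_poly k :: 'a poly) \<le> (k + 4) div 4"
    proof -
      have "degree (pCons 0 (trinom_poly k) :: 'a poly) \<le> Suc (degree (trinom_poly k :: 'a poly))"
        by (rule degree_pCons_le)
      also have "\<dots> \<le> Suc (k div 4)" using less[of k] n by auto
      finally show ?thesis by simp
    qed
    ultimately show ?thesis unfolding n trinom_poly_step by (intro degree_diff_le) auto
  qed (simp add: trinom_poly_base)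
qed

lemma poly_trinom_poly_step:
  "poly (trinom_poly (n + 4)) x = poly (trinom_poly (n + 3)) x - x * poly (trinom_poly n) x"
  by (simp add: trinom_poly_step)

lemma poly_trinom_poly_of_real:
  "poly (trinom_poly n) (of_real x :: 'a::{real_algebra_1,comm_ring_1}) = of_real (poly (trinom_poly n) x)"
proof (induction n rule: less_induct)
  case (less n)
  show ?case
  proof (cases "n < 4")
    case False
    then obtain k where n: "n = k + 4" by (metis add.commute le_Suc_ex not_less)
    show ?thesis using less[of k] less[of "k + 3"] by (simp add: n poly_trinom_poly_step)
  qed (simp add: trinom_poly_base)
qed

text \<open>
  The substitution \<open>t \<mapsto> Y t\<close> turns \<open>1 - t + x t ^ 4\<close> with \<open>x = \<alpha> / Y ^ 4\<close> into \<open>1 - Y t + \<alpha> t ^ 4\<close>. This is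
  used for \<open>H\<close> itself and for the normalised quartic with two roots on the unit circle.
\<close>

lemma scaled_trinom_poly:
  fixes Y \<alpha> :: "'a::field"
  assumes "Y \<noteq> 0"
    and "h 0 = 1" "h 1 = Y" "h 2 = Y ^ 2" "h 3 = Y ^ 3"
    and rec: "\<And>n. h (n + 4) = Y * h (n + 3) - \<alpha> * h n"
  shows "h n = Y ^ n * poly (trinom_poly n) (\<alpha> / Y ^ 4)"
proof (induction n rule: less_induct)
  case (less n)
  show ?case
  proof (cases "n < 4")
    case True
    then consider "n = 0" | "n = 1" | "n = 2" | "n = 3" by linarith
    then show ?thesis using assms by cases (simp_all add: trinom_poly_base)
  next
    case False
    then obtain k where n: "n = k + 4" by (metis add.commute le_Suc_ex not_less)
    have "h n = Y * (Y ^ (k + 3) * poly (trinom_poly (k + 3)) (\<alpha> / Y ^ 4))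
              - \<alpha> * (Y ^ k * poly (trinom_poly k) (\<alpha> / Y ^ 4))"
      using less[of k] less[of "k + 3"] by (simp add: n rec)
    also have "\<dots> = Y ^ n * poly (trinom_poly n) (\<alpha> / Y ^ 4)"
    proof -
      have "Y ^ n * (\<alpha> / Y ^ 4) = \<alpha> * Y ^ k" "Y ^ n = Y * Y ^ (k + 3)"
        using \<open>Y \<noteq> 0\<close> by (simp_all add: n power_add eval_nat_numeral)
      then show ?thesis
        by (simp only: n poly_trinom_poly_step right_diff_distrib mult.assoc[symmetric])
    qed
    finally show ?thesis .
  qed
qed

lemma genfun_recurrence:
  assumes "has_genfun4 A B H"
  shows "H 0 = 1" "H 1 = - B" "H 2 = B ^ 2" "H 3 = - (B ^ 3)"
    "H (n + 4) = - B * H (n + 3) - A * H n"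
proof -
  have eq: "Abs_fps H + fps_const B * (Abs_fps H * fps_X) + fps_const A * (Abs_fps H * fps_X ^ 4) = 1"
    using assms unfolding has_genfun4_def by (simp add: algebra_simps)
  have co: "H n + B * (if n = 0 then 0 else H (n - 1)) + A * (if n < 4 then 0 else H (n - 4))
      = (if n = 0 then 1 else 0)" for n
    using arg_cong[OF eq, of "\<lambda>f. fps_nth f n"]
    by (simp add: fps_X_power_mult_right_nth if_distrib cong: if_cong)
  show h0: "H 0 = 1" using co[of 0] by simp
  show h1: "H 1 = - B" using co[of 1] h0 by (simp add: add_eq_0_iff)
  show h2: "H 2 = B ^ 2" using co[of 2] h1 by (simp add: power2_eq_square)
  show "H 3 = - (B ^ 3)" using co[of 3] h2 by (simp add: add_eq_0_iff eval_nat_numeral)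
  have "H (n + 4) + B * H (n + 3) + A * H n = 0"
    using co[of "n + 4"] by (simp add: numeral_eq_Suc)
  then show "H (n + 4) = - B * H (n + 3) - A * H n"
    by algebra
qed

lemma poly_H_eq:
  assumes "has_genfun4 A B H" and "poly B z \<noteq> 0"
  shows "poly (H m) z = (- poly B z) ^ m * poly (trinom_poly m) (poly A z / poly B z ^ 4)"
proof -
  have "poly (H m) z = (- poly B z) ^ m * poly (trinom_poly m) (poly A z / (- poly B z) ^ 4)"
    by (rule scaled_trinom_poly[where h = "\<lambda>n. poly (H n) z"])
      (use assms(2) in \<open>simp_all add: genfun_recurrence[OF assms(1), simplified]\<close>)
  then show ?thesis by simp
qed

section \<open>The conjugate pair of roots and the damped remainder\<close>

text \<open>
  Partial fractions for
  \<open>1 - Y s + q s ^ 4 = (1 - 2 c s + s\<^sup>2) (1 + 2 c q s + q s\<^sup>2)\<close>. Here \<open>u\<close> and \<open>g\<close> are the solutions of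
  the two quadratic recurrences, so both sides satisfy the recurrence of order four and only the
  first four values have to be compared. For \<open>c = cos \<theta>\<close> the factor \<open>3 + 2 q + 3 q\<^sup>2\<close> is the
  squared modulus of \<open>1 + 2 c q s + q s\<^sup>2\<close> at \<open>s = exp (i \<theta>)\<close>.
\<close>

lemma trinomial_recurrence_closed_form:
  fixes c q :: real and u g h :: "nat \<Rightarrow> real"
  assumes q: "q * (4 * c\<^sup>2 - 1) = 1"
    and u: "u 0 = 0" "u 1 = 1" "\<And>n. u (n + 2) = 2 * c * u (n + 1) - u n"
    and g: "g 0 = 1" "g 1 = - 2 * c * q" "\<And>n. g (n + 2) = - 2 * c * q * g (n + 1) - q * g n"
    and Y: "Y = 2 * c * (1 - q)"
    and h: "h 0 = 1" "h 1 = Y" "h 2 = Y ^ 2" "h 3 = Y ^ 3"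
      "\<And>n. h (n + 4) = Y * h (n + 3) - q * h n"
  shows "(3 + 2 * q + 3 * q\<^sup>2) * h n =
    u (n + 1) + 2 * c * q * u (n + 2) + q * u (n + 3) - 4 * c * q * g (n + 1) - q * (1 - q) * g n"
proof -
  define R where "R n = u (n + 1) + 2 * c * q * u (n + 2) + q * u (n + 3)
    - 4 * c * q * g (n + 1) - q * (1 - q) * g n" for n
  have q': "4 * c\<^sup>2 * q = 1 + q" using q by (simp add: algebra_simps)
  have uv: "u 2 = 2*c*u 1 - u 0" "u 3 = 2*c*u 2 - u 1" "u 4 = 2*c*u 3 - u 2"
    "u 5 = 2*c*u 4 - u 3" "u 6 = 2*c*u 5 - u 4"
    using u(3)[of 0] u(3)[of 1] u(3)[of 2] u(3)[of 3] u(3)[of 4]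
    by (simp_all add: numeral_eq_Suc)
  have u2: "u 2 = 2 * c" using uv u(1,2) by simp
  have u3: "u 3 = 4 * c^2 - 1" using uv(2) u2 u(2) by algebra
  have u4: "u 4 = 8 * c^3 - 4 * c" using uv(3) u2 u3 by algebra
  have u5: "u 5 = 16 * c^4 - 12 * c^2 + 1" using uv(4) u4 u3 by algebra
  have u6: "u 6 = 32 * c^5 - 32 * c^3 + 6 * c" using uv(5) u4 u5 by algebra
  have gv: "g 2 = -2*c*q*g 1 - q * g 0" "g 3 = -2*c*q*g 2 - q * g 1"
    "g 4 = -2*c*q*g 3 - q * g 2"
    using g(3)[of 0] g(3)[of 1] g(3)[of 2] by (simp_all add: numeral_eq_Suc)
  have g2: "g 2 = 4 * c^2 * q^2 - q" using gv(1) g(1,2) by algebra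
  have g3: "g 3 = - 8 * c^3 * q^3 + 4 * c * q^2" using gv(2) g2 g(2) by algebra
  have g4: "g 4 = 16 * c^4 * q^4 - 12 * c^2 * q^3 + q^2" using gv(3) g2 g3 by algebra
  have us: "u (n + 2) = 2*c*u(n+1) - u n" "u (n + 3) = 2*c*u(n+2) - u (n + 1)"
    "u (n + 4) = 2*c*u(n+3) - u (n + 2)" "u (n + 5) = 2*c*u(n+4) - u (n + 3)"
    "u (n + 6) = 2*c*u(n+5) - u (n + 4)" "u (n + 7) = 2*c*u(n+6) - u (n + 5)" for n
    using u(3)[of n] u(3)[of "n+1"] u(3)[of "n+2"] u(3)[of "n+3"] u(3)[of "n+4"] u(3)[of "n+5"]
    by (simp_all add: eval_nat_numeral)
  have gs: "g (n+2) = -2*c*q*g(n+1) - q * g n" "g (n+3) = -2*c*q*g(n+2) - q * g (n+1)"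
    "g (n+4) = -2*c*q*g(n+3) - q * g (n+2)" "g (n+5) = -2*c*q*g(n+4) - q * g (n+3)" for n
    using g(3)[of n] g(3)[of "n+1"] g(3)[of "n+2"] g(3)[of "n+3"] by (simp_all add: eval_nat_numeral)
  have Rs: "R (n + 4) = Y * R (n + 3) - q * R n" for n
  proof -
    have U: "u (k + 4) = Y * u (k + 3) - q * u k" for k
      using us[of k] q' unfolding Y by algebra
    have G: "g (n + 4) = Y * g (n + 3) - q * g n"
      "g (n + 5) = Y * g (n + 4) - q * g (n + 1)"
      using gs[of n] q' unfolding Y by algebra+
    have UU: "u (n + 5) = Y * u (n + 4) - q * u (n + 1)"
      "u (n + 6) = Y * u (n + 5) - q * u (n + 2)" "u (n + 7) = Y * u (n + 6) - q * u (n + 3)"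
      using U[of "n+1"] U[of "n+2"] U[of "n+3"] by (simp_all add: add.commute)
    have RR: "R (n + 4) = u (n + 5) + 2*c*q * u (n + 6) + q * u (n + 7)
        - 4*c*q * g (n + 5) - q*(1 - q) * g (n + 4)"
      "R (n + 3) = u (n + 4) + 2*c*q * u (n + 5) + q * u (n + 6)
        - 4*c*q * g (n + 4) - q*(1 - q) * g (n + 3)"
      by (simp_all add: R_def add.commute)
    show ?thesis
      unfolding RR UU G R_def[of n] by algebra
  qed
  have "(3 + 2 * q + 3 * q\<^sup>2) * h n = R n"
  proof (induction n rule: less_induct)
    case (less n)
    show ?case
    proof (cases "n < 4")
      case True
      then consider "n = 0" | "n = 1" | "n = 2" | "n = 3" by linarith
      then show ?thesis
      proof cases
        case 1
        have "R 0 = 1 + 2*c*q*(2*c) + q*(4*c^2-1) - 4*c*q*(-2*c*q) - q*(1-q)"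
          unfolding R_def using u u2 u3 g by simp
        then show ?thesis unfolding 1 h(1) using q' by algebra
      next
        case 2
        have "R 1 = u 2 + 2*c*q*u 3 + q*u 4 - 4*c*q*g 2 - q*(1-q)*g 1"
          unfolding R_def by (simp add: numeral_eq_Suc)
        then show ?thesis unfolding 2 u2 u3 u4 g2 g h Y using q' by algebra
      next
        case 3
        have "R 2 = u 3 + 2*c*q*u 4 + q*u 5 - 4*c*q*g 3 - q*(1-q)*g 2"
          unfolding R_def by (simp add: numeral_eq_Suc)
        then show ?thesis unfolding 3 u5 u3 u4 g2 g3 h Y using q' by algebra
      next
        case 4
        have "R 3 = u 4 + 2*c*q*u 5 + q*u 6 - 4*c*q*g 4 - q*(1-q)*g 3"
          unfolding R_def by (simp add: numeral_eq_Suc)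
        then show ?thesis unfolding 4 u5 u6 u4 g4 g3 h Y using q' by algebra
      qed
    next
      case False
      then obtain k where n: "n = k + 4" by (metis add.commute le_Suc_ex not_less)
      have "(3 + 2 * q + 3 * q\<^sup>2) * h k = R k"
        "(3 + 2 * q + 3 * q\<^sup>2) * h (k + 3) = R (k + 3)"
        using less[of k] less[of "k + 3"] n by simp_all
      moreover have "K * (Y * a - q * b) = Y * (K * a) - q * (K * b)" for K a b :: real
        by (simp add: algebra_simps)
      ultimately show ?thesis by (simp only: n h Rs)
    qed
  qed
  then show ?thesis by (simp add: R_def)
qed

text \<open>
  The quadratic form \<open>X\<^sup>2 + 2 c q X Y + q Y\<^sup>2\<close> in two consecutive terms is multiplied by exactly \<open>q\<close>
  at each step. Because \<open>q c\<^sup>2 = (1 + q) / 4 < 1 / 2\<close>, its discriminant is less than \<open>- 2 q\<close>, so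
  the form controls each term, with a constant that does not degenerate as \<open>q\<close> approaches 1.
\<close>

lemma damped_seq_bound:
  fixes c q :: real and g :: "nat \<Rightarrow> real"
  assumes q: "q * (4 * c\<^sup>2 - 1) = 1" "0 < q" "q < 1"
    and g: "g 0 = 1" "g 1 = - 2 * c * q" "\<And>n. g (n + 2) = - 2 * c * q * g (n + 1) - q * g n"
  shows "(g n)\<^sup>2 \<le> 2 * q ^ n"
proof -
  have q': "4 * c\<^sup>2 * q = 1 + q" using q by (simp add: algebra_simps)
  have inv: "(g (n + 1))\<^sup>2 + 2 * c * q * g (n + 1) * g n + q * (g n)\<^sup>2 = q ^ (n + 1)"
  proof (induction n)
    case 0
    then show ?case using g by (simp add: power2_eq_square)
  next
    case (Suc n)
    have "g (Suc n + 1) = - 2 * c * q * g (n + 1) - q * g n" using g(3)[of n] by simp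
    then have "(g (Suc n + 1))\<^sup>2 + 2 * c * q * g (Suc n + 1) * g (n + 1) + q * (g (n + 1))\<^sup>2
      = q * ((g (n + 1))\<^sup>2 + 2 * c * q * g (n + 1) * g n + q * (g n)\<^sup>2)"
      by algebra
    then show ?case using Suc by simp
  qed
  have "(g (n + 1) + c * q * g n)\<^sup>2 + q * (1 - q * c\<^sup>2) * (g n)\<^sup>2 = q ^ (n + 1)"
    using inv by (simp add: power2_eq_square algebra_simps)
  then have "q * (1 - q * c\<^sup>2) * (g n)\<^sup>2 \<le> q ^ (n + 1)" by (smt (verit) zero_le_power2)
  then have "(1 - q * c\<^sup>2) * (g n)\<^sup>2 \<le> q ^ n" using q by (simp add: mult.assoc)
  moreover have "1 - q * c\<^sup>2 \<ge> 1 / 2" using q' q by (simp add: mult.commute)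
  then have "1 / 2 * (g n)\<^sup>2 \<le> (1 - q * c\<^sup>2) * (g n)\<^sup>2" by (rule mult_right_mono) simp
  ultimately show ?thesis by simp
qed

text \<open>
  This is \<open>b ^ 4 / a\<close> when two conjugate roots of \<open>1 + b t + a t ^ 4\<close> have arguments \<open>\<theta>\<close>, \<open>- \<theta>\<close> and
  \<open>c = cos \<theta>\<close>; in terms of \<open>\<theta>\<close> it equals \<open>sin (4 \<theta>) ^ 4 / (sin \<theta> * sin (3 \<theta>) ^ 3)\<close> where this is
  defined.
\<close>

definition ratio_of_cos :: "real \<Rightarrow> real" where
  "ratio_of_cos c = (4 * c * (2 * c\<^sup>2 - 1)) ^ 4 / (4 * c\<^sup>2 - 1) ^ 3"

lemma ratio_of_cos_eq:
  assumes "0 < 4 * c\<^sup>2 - 1" and "q = 1 / (4 * c\<^sup>2 - 1)"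
  shows "ratio_of_cos c = (2 * c * (1 - q)) ^ 4 / q"
proof -
  define D where "D = 4 * c\<^sup>2 - 1"
  have "1 - q = (4 * c\<^sup>2 - 2) / D" using assms by (simp add: D_def field_simps)
  then have "2 * c * (1 - q) = 4 * c * (2 * c\<^sup>2 - 1) / D"
    by (simp add: right_diff_distrib mult_ac)
  then have "(2 * c * (1 - q)) ^ 4 / q = (4 * c * (2 * c\<^sup>2 - 1)) ^ 4 / D ^ 4 * D"
    using assms by (simp add: D_def power_divide)
  also have "\<dots> = ratio_of_cos c"
  proof -
    have "D ^ 4 = D ^ 3 * D" "D \<noteq> 0" using assms(1) by (simp_all add: D_def eval_nat_numeral)
    then show ?thesis by (simp add: ratio_of_cos_def D_def[symmetric])
  qed
  finally show ?thesis by simp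
qed

text \<open>
  As \<open>c\<close> grows, \<open>q = 1 / (4 c\<^sup>2 - 1)\<close> decreases, so the numerator of \<open>(2 c (1 - q)) ^ 4 / q\<close> grows
  and its denominator shrinks.
\<close>

lemma ratio_of_cos_strict_mono:
  assumes "0 < a" "1 \<le> 2 * a\<^sup>2" "a < b"
  shows "ratio_of_cos a < ratio_of_cos b"
proof -
  define p where "p x = 1 / (4 * x\<^sup>2 - 1)" for x :: real
  have sq: "a\<^sup>2 < b\<^sup>2" using assms by (intro power_strict_mono) auto
  have pb: "0 < p b" "p b < p a" "p a \<le> 1"
    using sq assms by (auto simp: p_def field_simps)
  have "2 * a * (1 - p a) < 2 * b * (1 - p b)"
    using assms pb by (intro mult_le_less_imp_less) auto
  then have "(2 * a * (1 - p a)) ^ 4 < (2 * b * (1 - p b)) ^ 4"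
    using assms pb by (intro power_strict_mono) auto
  then have "(2 * a * (1 - p a)) ^ 4 / p a < (2 * b * (1 - p b)) ^ 4 / p b"
    using assms pb by (intro frac_less) auto
  moreover have "ratio_of_cos a = (2 * a * (1 - p a)) ^ 4 / p a"
    "ratio_of_cos b = (2 * b * (1 - p b)) ^ 4 / p b"
    using sq assms(2) by (simp_all add: p_def ratio_of_cos_eq[OF _ refl])
  ultimately show ?thesis by simp
qed

lemma ratio_of_cos_pos: "0 < c \<Longrightarrow> 1 < 2 * c\<^sup>2 \<Longrightarrow> 0 < ratio_of_cos c"
  by (simp add: ratio_of_cos_def)

section \<open>Signs at the nodes\<close>

lemma sin_ge_half:
  fixes t :: real
  assumes "0 \<le> t" "t \<le> pi / 2"
  shows "t / 2 \<le> sin t"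
proof -
  have "\<bar>sin t - (\<Sum>m<3. sin_coeff m * t ^ m)\<bar> \<le> inverse (fact 3) * \<bar>t\<bar> ^ 3"
    by (rule Maclaurin_sin_bound)
  then have "\<bar>sin t - t\<bar> \<le> t ^ 3 / 6"
    using assms by (simp add: eval_nat_numeral sin_coeff_def fact_numeral field_simps)
  then have 1: "t - t ^ 3 / 6 \<le> sin t" by linarith
  have "t \<le> 1.6" using assms pi_approx by simp
  then have "t * t \<le> 1.6 * 1.6" using assms by (intro mult_mono) auto
  then have "t * (t * t) \<le> t * 3" using assms by (intro mult_left_mono) auto
  with 1 show ?thesis by (simp add: eval_nat_numeral)
qed

fun damped_seq :: "real \<Rightarrow> real \<Rightarrow> nat \<Rightarrow> real" where
  "damped_seq c q 0 = 1"
| "damped_seq c q (Suc 0) = - 2 * c * q"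
| "damped_seq c q (Suc (Suc n)) = - 2 * c * q * damped_seq c q (Suc n) - q * damped_seq c q n"

text \<open>
  The gain over 1 is what beats the lack of uniform damping: \<open>q\<close> tends to 1 as the angle tends
  to \<open>pi / 4\<close>, but the last node stays at distance at least \<open>pi / (4 (m + 1))\<close> from \<open>pi / 4\<close>, and
  a relative gain of order \<open>1 / m\<close> per step suffices to push \<open>q ^ m\<close> below \<open>1 / 2\<close>.
\<close>

lemma node_angle:
  assumes "4 * k \<le> m" and "c = cos (real k * pi / real (m + 1))"
  shows "0 < c" "1 + 3 / (2 * (real m + 1)) \<le> 4 * c\<^sup>2 - 1"
proof -
  define \<theta> where "\<theta> = real k * pi / real (m + 1)"
  have k: "4 * real k \<le> real m" using assms(1) by linarith
  define t where "t = pi / 2 - 2 * \<theta>"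
  have t: "t = pi * (real m + 1 - 4 * real k) / (2 * (real m + 1))"
    by (simp add: t_def \<theta>_def field_simps)
  have "pi * 1 / (2 * (real m + 1)) \<le> t"
    unfolding t using k by (intro divide_right_mono mult_left_mono) auto
  then have t1: "3 / (2 * (real m + 1)) \<le> t"
    using pi_gt3 by (smt (verit) divide_right_mono of_nat_0_le_iff)
  have th: "0 \<le> \<theta>" by (simp add: \<theta>_def)
  have t0: "0 < t" using t1 by (smt (verit) divide_pos_pos of_nat_0_le_iff)
  have "t / 2 \<le> sin t" using t0 th by (intro sin_ge_half) (auto simp: t_def)
  then have "t / 2 \<le> cos (2 * \<theta>)" by (simp add: t_def sin_diff)
  moreover have "cos (2 * \<theta>) = 2 * c\<^sup>2 - 1"
    unfolding cos_double_cos using assms(2) by (simp add: \<theta>_def)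
  ultimately show "1 + 3 / (2 * (real m + 1)) \<le> 4 * c\<^sup>2 - 1" using t1 by linarith
  show "0 < c" unfolding assms(2) \<theta>_def[symmetric]
    using th t0 by (intro cos_gt_zero_pi) (auto simp: t_def)
qed

text \<open>
  At the node the oscillating part of the closed form reduces to \<open>4 c q (-1) ^ k\<close>, because
  \<open>sin ((m + 1) \<theta>) = 0\<close>. The damped part is at most \<open>4 c q * sqrt (2 * q ^ m)\<close> in absolute value, and
  \<open>2 * q ^ m < 1\<close>.
\<close>

lemma sign_at_node:
  assumes k: "1 \<le> k" "4 * k \<le> m" and c: "c = cos (real k * pi / real (m + 1))"
  shows "0 < (-1) ^ k * poly (trinom_poly m) (1 / ratio_of_cos c)"
proof -
  define \<theta> where "\<theta> = real k * pi / real (m + 1)"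
  define q where "q = 1 / (4 * c\<^sup>2 - 1)"
  define Y where "Y = 2 * c * (1 - q)"
  define \<epsilon> :: real where "\<epsilon> = (-1) ^ k"
  define u where "u n = sin (real n * \<theta>) / sin \<theta>" for n :: nat
  define g where "g = damped_seq c q"
  define h where "h n = Y ^ n * poly (trinom_poly n) (q / Y ^ 4)" for n
  have cth: "c = cos \<theta>" using c by (simp add: \<theta>_def)
  note na = node_angle[OF k(2) c]
  have c0: "0 < c" and D: "1 < 4 * c\<^sup>2 - 1" "4 * c\<^sup>2 - 1 \<noteq> 0"
    using na by (smt (verit) divide_pos_pos of_nat_0_le_iff)+
  have q: "q * (4 * c\<^sup>2 - 1) = 1" "0 < q" "q < 1" using D by (auto simp: q_def)
  have Y0: "0 < Y" using c0 q by (simp add: Y_def)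
  have "pi * real k < pi * real (m + 1)" using k by (intro mult_strict_left_mono) auto
  then have "\<theta> < pi" by (simp add: \<theta>_def field_simps)
  moreover have "0 < \<theta>" using k by (simp add: \<theta>_def)
  ultimately have s: "sin \<theta> \<noteq> 0" using sin_gt_zero by force
  have urec: "u (n + 2) = 2 * c * u (n + 1) - u n" for n
  proof -
    have "sin (real (n + 2) * \<theta>) + sin (real n * \<theta>) = 2 * sin (real (n + 1) * \<theta>) * cos \<theta>"
      using sin_add[of "real (n + 1) * \<theta>" \<theta>] sin_diff[of "real (n + 1) * \<theta>" \<theta>]
      by (simp add: algebra_simps)
    then show ?thesis using s by (simp add: u_def cth field_simps)
  qed
  have grec: "g 0 = 1" "g 1 = - 2 * c * q" "g (n + 2) = - 2 * c * q * g (n + 1) - q * g n" for n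
    by (simp_all add: g_def)
  have "(3 + 2 * q + 3 * q\<^sup>2) * h m =
    u (m + 1) + 2 * c * q * u (m + 2) + q * u (m + 3) - 4 * c * q * g (m + 1) - q * (1 - q) * g m"
  proof (rule trinomial_recurrence_closed_form[OF q(1) _ _ urec grec Y_def])
    show "h (n + 4) = Y * h (n + 3) - q * h n" for n
    proof -
      have "Y ^ (n + 4) * (q / Y ^ 4) = q * Y ^ n" "Y ^ (n + 4) = Y * Y ^ (n + 3)"
        using Y0 by (simp_all add: power_add eval_nat_numeral)
      then show ?thesis
        by (simp only: h_def poly_trinom_poly_step right_diff_distrib mult.assoc[symmetric])
    qed
  qed (use s in \<open>auto simp: u_def h_def trinom_poly_base\<close>)
  moreover have u1: "u (m + 1) = 0"
    by (simp add: u_def \<theta>_def)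
  moreover have u2: "u (m + 2) = \<epsilon>"
  proof -
    have "real (m + 2) * \<theta> = real k * pi + \<theta>" by (simp add: \<theta>_def field_simps)
    then show ?thesis using s by (simp add: u_def sin_add \<epsilon>_def)
  qed
  moreover have "u (m + 3) = 2 * c * \<epsilon>"
    using urec[of "m + 1"] u1 u2 by (simp add: numeral_eq_Suc)
  ultimately have main: "(3 + 2 * q + 3 * q\<^sup>2) * h m
      = q * (4 * c * \<epsilon> - (4 * c * g (m + 1) + (1 - q) * g m))"
    by (simp add: algebra_simps)
  \<comment> \<open>Bernoulli applied to the lower bound for \<open>1 / q = 4 c\<^sup>2 - 1\<close>.\<close>
  have "2 * q ^ m < 1"
  proof -
    have "2 < 1 + real m * (3 / (2 * (real m + 1)))" using k by (simp add: field_simps)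
    also have "\<dots> \<le> (1 + 3 / (2 * (real m + 1))) ^ m"
      by (rule Bernoulli_inequality) (smt (verit) divide_nonneg_nonneg of_nat_0_le_iff)
    also have "\<dots> \<le> (4 * c\<^sup>2 - 1) ^ m"
      using na(2) by (intro power_mono) auto
    finally show ?thesis using D by (simp add: q_def power_divide)
  qed
  define r where "r = sqrt q"
  define s where "s = sqrt (2 * q ^ m)"
  have r: "0 < r" "r < 1" "q = r * r" using q by (auto simp: r_def)
  have s1: "0 \<le> s" "s < 1" using \<open>2 * q ^ m < 1\<close> q by (auto simp: s_def)
  have "\<bar>g m\<bar> \<le> s"
    using damped_seq_bound[OF q grec, of m] unfolding s_def by (metis real_sqrt_abs real_sqrt_le_mono)
  moreover have "\<bar>g (m + 1)\<bar> \<le> s * r"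
  proof -
    have "\<bar>g (m + 1)\<bar> \<le> sqrt (2 * q ^ (m + 1))"
      using damped_seq_bound[OF q grec, of "m + 1"] by (metis real_sqrt_abs real_sqrt_le_mono)
    then show ?thesis by (simp add: s_def r_def real_sqrt_mult mult_ac)
  qed
  ultimately have "\<bar>4 * c * g (m + 1) + (1 - q) * g m\<bar> \<le> 4 * c * (s * r) + (1 - q) * s"
    using c0 q by (intro order.trans[OF abs_triangle_ineq] add_mono) (auto simp: abs_mult)
  \<comment> \<open>With \<open>q = r\<^sup>2\<close>, the factor \<open>1 - q = (1 - r) (1 + r)\<close> is at most \<open>(1 - r) * 4 c\<close>, so the two
    summands combine without loss to \<open>4 c s\<close>.\<close>
  also have "(1 - q) * s \<le> (4 * c * (1 - r)) * s"
  proof (rule mult_right_mono)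
    have "1 / 2 < c"
    proof (rule ccontr)
      assume "\<not> 1 / 2 < c"
      then have "c\<^sup>2 \<le> (1 / 2)\<^sup>2" using c0 by (intro power_mono) auto
      then show False using D by (simp add: power_divide)
    qed
    then have "(1 + r) * (1 - r) \<le> (4 * c) * (1 - r)" using r by (intro mult_right_mono) auto
    then show "1 - q \<le> 4 * c * (1 - r)" using r by (simp add: algebra_simps)
  qed (fact s1)
  also have "4 * c * (s * r) + (4 * c * (1 - r)) * s = (4 * c) * s" by (simp add: algebra_simps)
  also have "\<dots> < 4 * c" using c0 s1 by simp
  finally have small: "\<bar>4 * c * g (m + 1) + (1 - q) * g m\<bar> < 4 * c" by simp
  have eps: "\<epsilon> = 1 \<or> \<epsilon> = -1" by (cases "even k") (auto simp: \<epsilon>_def)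
  then have "0 < \<epsilon> * (4 * c * \<epsilon> - (4 * c * g (m + 1) + (1 - q) * g m))"
    using small by auto
  then have "0 < q * (\<epsilon> * (4 * c * \<epsilon> - (4 * c * g (m + 1) + (1 - q) * g m)))"
    using q by simp
  then have "0 < (3 + 2 * q + 3 * q\<^sup>2) * (\<epsilon> * h m)" using main by (simp add: mult_ac)
  moreover have "0 < 3 + 2 * q + 3 * q\<^sup>2" using q by (simp add: add_pos_nonneg)
  ultimately have "0 < \<epsilon> * h m" by (simp only: zero_less_mult_pos)
  then have "0 < Y ^ m * (\<epsilon> * poly (trinom_poly m) (q / Y ^ 4))" by (simp only: h_def mult.left_commute)
  then have "0 < \<epsilon> * poly (trinom_poly m) (q / Y ^ 4)" using Y0 by (simp only: zero_less_mult_pos zero_less_power)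
  moreover have "ratio_of_cos c = Y ^ 4 / q" unfolding Y_def using D by (intro ratio_of_cos_eq) (auto simp: q_def)
  ultimately show ?thesis by (simp add: \<epsilon>_def)
qed

text \<open>
  At \<open>x = 27/256\<close> the quartic \<open>1 - t + x t ^ 4\<close> has the double root \<open>4/3\<close>. The ratio of consecutive
  values never drops below its reciprocal, since \<open>1 - 27/256 * (4/3) ^ 3 = 3/4\<close>.
\<close>

lemma trinom_poly_pos_at_27_256: "0 < poly (trinom_poly n) (27 / 256 :: real)"
proof -
  have "0 < poly (trinom_poly n) (27 / 256 :: real) \<and>
    3 / 4 * poly (trinom_poly n) (27 / 256 :: real) \<le> poly (trinom_poly (n + 1)) (27 / 256)"
  proof (induction n rule: less_induct)
    case (less n)
    show ?case
    proof (cases "n < 3")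
      case True
      then show ?thesis by (simp add: trinom_poly_base)
    next
      case False
      then obtain k where n: "n = k + 3" by (metis add.commute le_Suc_ex not_less)
      have "poly (trinom_poly (k + 4)) (27 / 256 :: real)
          = poly (trinom_poly (k + 3)) (27 / 256) - 27 / 256 * poly (trinom_poly k) (27 / 256)"
        by (rule poly_trinom_poly_step)
      then show ?thesis using less[of k] less[of "k + 1"] less[of "k + 2"]
        unfolding n by (simp add: numeral_eq_Suc)
    qed
  qed
  then show ?thesis ..
qed

section \<open>Counting and spacing of the roots\<close>

lemma sign_change_root:
  fixes p :: "real poly"
  assumes "a < b" "0 < (-1) ^ k * poly p a" "0 < (-1) ^ Suc k * poly p b"
  shows "\<exists>x>a. x < b \<and> poly p x = 0"
  using assms by (cases "even k") (auto dest: poly_IVT_pos poly_IVT_neg)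

text \<open>
  As many sign changes as the degree allows leave no room for further roots, real or not.
\<close>

lemma roots_of_alternating:
  fixes p :: "real poly" and P :: "'a::real_normed_field poly" and X :: "nat \<Rightarrow> real"
  assumes P: "\<And>x. poly P (of_real x) = of_real (poly p x)"
    and deg: "degree P \<le> K"
    and mono: "\<And>k. k < K \<Longrightarrow> X k < X (Suc k)"
    and sign: "\<And>k. k \<le> K \<Longrightarrow> 0 < (-1) ^ k * poly p (X k)"
    and root: "poly P z = 0"
  obtains x where "z = of_real x" "X 0 < x"
proof -
  have mono_le: "X i \<le> X j" if "i \<le> j" "j \<le> K" for i j
    using that
  proof (induction j)
    case (Suc j)
    then show ?case using mono[of j] by (cases "i = Suc j") auto
  qed simp
  have "\<exists>x. X k < x \<and> x < X (Suc k) \<and> poly p x = 0" if k: "k < K" for k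
    using sign_change_root[OF mono[OF k] sign[of k] sign[of "Suc k"]] k by auto
  then obtain r where r: "\<And>k. k < K \<Longrightarrow> X k < r k \<and> r k < X (Suc k) \<and> poly p (r k) = 0"
    by metis
  have "r i < r j" if "i < j" "j < K" for i j
    using r[of i] r[of j] mono_le[of "Suc i" j] that by force
  then have inj: "inj_on r {..<K}" by (metis inj_onI lessThan_iff linorder_neqE_nat order_less_irrefl)
  define S where "S = (of_real ` r ` {..<K} :: 'a set)"
  have cS: "card S = K"
    unfolding S_def image_image
    using inj by (subst card_image) (auto simp: inj_on_def)
  have P0: "P \<noteq> 0" using sign[of 0] P[of "X 0"] by auto
  have "S = {z. poly P z = 0}"
  proof (rule card_seteq)
    show "finite {z. poly P z = 0}" using P0 by (rule poly_roots_finite)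
    show "S \<subseteq> {z. poly P z = 0}" using r by (auto simp: S_def P)
    show "card {z. poly P z = 0} \<le> card S"
      using card_poly_roots_bound[OF P0] deg cS by simp
  qed
  then have "z \<in> S" using root by simp
  then obtain k where k: "k < K" "z = of_real (r k)" by (auto simp: S_def)
  have "X 0 < r k" using r[OF k(1)] mono_le[of 0 k] k(1) by force
  then show ?thesis using that k(2) by blast
qed

lemma node_cos_decreasing:
  assumes "4 * k \<le> m" "j < k"
  shows "cos (real k * pi / real (m + 1)) < cos (real j * pi / real (m + 1))"
proof (rule cos_monotone_0_pi)
  show "real j * pi / real (m + 1) < real k * pi / real (m + 1)"
    using assms by (intro divide_strict_right_mono mult_strict_right_mono) auto
  have "real k * pi \<le> real (m + 1) * pi" using assms by (intro mult_right_mono) auto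
  then show "real k * pi / real (m + 1) \<le> pi" by (simp add: field_simps)
qed simp

text \<open>
  The cosine reverses the order of the nodes, so reciprocals of these values increase with \<open>k\<close>.
\<close>

lemma ratio_at_nodes:
  assumes "4 * k \<le> m" "j < k"
  shows "0 < ratio_of_cos (cos (real k * pi / real (m + 1)))"
    "ratio_of_cos (cos (real k * pi / real (m + 1))) < ratio_of_cos (cos (real j * pi / real (m + 1)))"
proof -
  define c where "c = cos (real k * pi / real (m + 1))"
  have "0 < c" "1 + 3 / (2 * (real m + 1)) \<le> 4 * c\<^sup>2 - 1"
    using node_angle[OF assms(1) c_def] by auto
  moreover have "0 < 3 / (2 * (real m + 1))" by (simp add: add_nonneg_pos)
  ultimately have c: "0 < c" "1 < 2 * c\<^sup>2" by linarith+
  show "0 < ratio_of_cos (cos (real k * pi / real (m + 1)))"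
    using ratio_of_cos_pos[OF c] by (simp add: c_def)
  show "ratio_of_cos (cos (real k * pi / real (m + 1))) < ratio_of_cos (cos (real j * pi / real (m + 1)))"
    using ratio_of_cos_strict_mono[OF c(1)] c(2) node_cos_decreasing[OF assms] by (simp add: c_def)
qed

lemma ratio_of_cos_1: "ratio_of_cos 1 = 256 / 27"
  by (simp add: ratio_of_cos_def)

lemma trinom_poly_roots:
  assumes "poly (trinom_poly m) z = (0::complex)"
  obtains x where "z = of_real x" "27 / 256 < x"
proof -
  define X where "X k = 1 / ratio_of_cos (cos (real k * pi / real (m + 1)))" for k :: nat
  show ?thesis
  proof (rule roots_of_alternating[of "trinom_poly m" "trinom_poly m" "m div 4" X z])
    fix k assume "k < m div 4"
    then have "4 * Suc k \<le> m" by presburger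
    then show "X k < X (Suc k)"
      unfolding X_def using ratio_at_nodes[of "Suc k" m k]
      by (intro divide_strict_left_mono) (auto intro!: mult_pos_pos)
  next
    fix k assume "k \<le> m div 4"
    then have k: "4 * k \<le> m" by presburger
    show "0 < (-1) ^ k * poly (trinom_poly m) (X k)"
    proof (cases "k = 0")
      case True
      then show ?thesis using trinom_poly_pos_at_27_256[of m] by (simp add: X_def ratio_of_cos_1)
    next
      case False
      then show ?thesis unfolding X_def using k by (intro sign_at_node) auto
    qed
  next
    fix x assume "z = of_real x" "X 0 < x"
    then show ?thesis using that by (simp add: X_def ratio_of_cos_1)
  qed (use assms degree_trinom_poly in \<open>auto simp: poly_trinom_poly_of_real\<close>)
qed

text \<open>
  By continuity, \<open>ratio_of_cos (cos \<theta>)\<close> stays within \<open>e\<close> of \<open>w0\<close> for \<open>\<theta>\<close> in some interval inside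
  \<open>[0, pi / 4]\<close>. Once the node spacing is less than half its length, it contains two consecutive
  nodes, and these have opposite signs.
\<close>

lemma trinom_poly_roots_dense:
  fixes w0 e :: real
  assumes w0: "0 \<le> w0" "w0 \<le> 256 / 27" and e: "0 < e"
  shows "\<forall>\<^sub>F m in sequentially. \<exists>x > 0. poly (trinom_poly m) x = 0 \<and> \<bar>1 / x - w0\<bar> < e"
proof -
  define \<phi> where "\<phi> \<theta> = ratio_of_cos (cos \<theta>)" for \<theta> :: real
  have c2: "1 \<le> 4 * (cos \<theta>)\<^sup>2 - 1" if "0 \<le> \<theta>" "\<theta> \<le> pi / 4" for \<theta> :: real
  proof -
    have "0 \<le> cos (2 * \<theta>)" using that by (intro cos_ge_zero) auto
    then show ?thesis by (simp add: cos_double_cos)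
  qed
  have cont: "continuous_on {0..pi/4} \<phi>"
    unfolding \<phi>_def ratio_of_cos_def using c2 by (intro continuous_intros) force
  have "\<phi> 0 = 256 / 27" by (simp add: \<phi>_def ratio_of_cos_1)
  moreover have "\<phi> (pi / 4) = 0" by (simp add: \<phi>_def ratio_of_cos_def cos_45 power_divide)
  ultimately obtain \<theta>0 where \<theta>0: "0 \<le> \<theta>0" "\<theta>0 \<le> pi / 4" "\<phi> \<theta>0 = w0"
    using IVT2'[of \<phi> "pi / 4" w0 0] cont w0 by auto
  have "\<theta>0 \<in> {0..pi / 4}" using \<theta>0 by simp
  from cont[unfolded continuous_on_iff dist_real_def, rule_format, OF this e] \<theta>0(3)
  obtain d where d: "0 < d"
    "\<And>\<theta>. 0 \<le> \<theta> \<Longrightarrow> \<theta> \<le> pi / 4 \<Longrightarrow> \<bar>\<theta> - \<theta>0\<bar> < d \<Longrightarrow> \<bar>\<phi> \<theta> - w0\<bar> < e" by auto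
  define l where "l = max 0 (\<theta>0 - d)"
  define r where "r = min (pi / 4) (\<theta>0 + d)"
  have lr: "0 \<le> l" "l < r" "r \<le> pi / 4"
    unfolding l_def r_def using d(1) \<theta>0(1,2) pi_gt_zero by linarith+
  have near: "\<bar>\<phi> \<theta> - w0\<bar> < e" if "l < \<theta>" "\<theta> < r" for \<theta>
    using that lr unfolding l_def r_def by (intro d(2)) linarith+
  obtain M :: nat where M: "2 * pi / (r - l) < real M" using reals_Archimedean2 by blast
  show ?thesis
  proof (rule eventually_sequentiallyI[of M])
    fix m assume "M \<le> m"
    have N0: "0 < real (m + 1)" by simp
    from \<open>M \<le> m\<close> have "2 * pi / (r - l) < real (m + 1)" using M by linarith
    then have gap: "2 * pi / real (m + 1) < r - l"
      using lr N0 by (simp only: pos_divide_less_eq diff_gt_0_iff_gt mult.commute)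
    \<comment> \<open>The node \<open>k\<close> is the first one to the right of \<open>l\<close>; it is not the node 0 since \<open>l \<ge> 0\<close>.\<close>
    define k where "k = nat \<lfloor>l * real (m + 1) / pi\<rfloor> + 1"
    have "0 \<le> l * real (m + 1) / pi" using lr by simp
    then have k: "l * real (m + 1) / pi < real k" "real k \<le> l * real (m + 1) / pi + 1"
      unfolding k_def by linarith+
    have k1: "l < real k * pi / real (m + 1)"
      using k(1) by (simp only: pos_divide_less_eq pos_less_divide_eq pi_gt_zero N0)
    have "real (k + 1) * pi / real (m + 1) \<le> (l * real (m + 1) / pi + 2) * pi / real (m + 1)"
      using k(2) by (intro divide_right_mono mult_right_mono) auto
    also have "\<dots> = l + 2 * pi / real (m + 1)"
    proof -
      have "(l * real (m + 1) / pi + 2) * pi = l * real (m + 1) + 2 * pi"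
        by (simp add: distrib_right)
      then show ?thesis using N0 by (simp only: add_divide_distrib) simp
    qed
    finally have k2: "real (k + 1) * pi / real (m + 1) < r" using gap by linarith
    have k12: "real k * pi / real (m + 1) < real (k + 1) * pi / real (m + 1)"
      by (intro divide_strict_right_mono mult_strict_right_mono) auto
    have "real (k + 1) * pi / real (m + 1) < pi / 4" using k2 lr by linarith
    then have "real (k + 1) * pi < pi / 4 * real (m + 1)" by (simp only: pos_divide_less_eq N0)
    then have "pi * real (k + 1) < pi * (real (m + 1) / 4)" by (simp only: mult.commute) simp
    then have "real (k + 1) < real (m + 1) / 4" by (simp only: mult_less_cancel_left_pos pi_gt_zero)
    then have "real (4 * (k + 1)) < real (m + 1)" by simp
    then have k4: "4 * (k + 1) \<le> m" unfolding of_nat_less_iff by simp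
    define X where "X j = ratio_of_cos (cos (real j * pi / real (m + 1)))" for j
    have X: "0 < X (k + 1)" "X (k + 1) < X k"
      unfolding X_def using ratio_at_nodes[OF k4, of k] by auto
    have "1 / X k < 1 / X (k + 1)" using X by (intro divide_strict_left_mono) auto
    moreover have "0 < (-1) ^ k * poly (trinom_poly m) (1 / X k)"
      unfolding X_def by (rule sign_at_node[OF _ _ refl]) (use k4 in \<open>auto simp: k_def\<close>)
    moreover have "0 < (-1) ^ Suc k * poly (trinom_poly m) (1 / X (k + 1))"
      unfolding X_def Suc_eq_plus1 by (rule sign_at_node[OF _ k4 refl]) simp
    ultimately obtain x where x: "1 / X k < x" "x < 1 / X (k + 1)" "poly (trinom_poly m) x = 0"
      using sign_change_root by blast
    have "0 < 1 / X k" using X by simp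
    then have x0: "0 < x" using x(1) by linarith
    have "0 < X k" using X by linarith
    then have "1 / x < X k" using x(1) x0 by (simp add: divide_less_eq mult.commute)
    moreover have "X (k + 1) < 1 / x" using x(2) x0 X(1) by (simp add: less_divide_eq mult.commute)
    moreover have "\<bar>X k - w0\<bar> < e"
      using near[OF k1 less_trans[OF k12 k2]] by (simp only: X_def \<phi>_def)
    moreover have "\<bar>X (k + 1) - w0\<bar> < e"
      using near[OF less_trans[OF k1 k12] k2] by (simp only: X_def \<phi>_def)
    ultimately have "\<bar>1 / x - w0\<bar> < e" by linarith
    then show "\<exists>x > 0. poly (trinom_poly m) x = 0 \<and> \<bar>1 / x - w0\<bar> < e" using x(3) x0 by blast
  qed
qed

section \<open>The quotient as an open map\<close>

text \<open>
  If the quotient were constant near \<open>p\<close>, its value would be a real number in \<open>[0, 256/27]\<close> because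
  \<open>p\<close> lies on the curve, and the polynomial identity \<open>B ^ 4 = c A\<close> would follow from infinitely many
  zeros; this is the degenerate case. Otherwise the open mapping theorem applies.
\<close>

lemma quotient_image_open:
  assumes nd: "\<not> degenerate4 A B" and p: "p \<in> curve4 A B" and U: "open U" "p \<in> U"
  obtains e where "0 < e"
    "ball (poly B p ^ 4 / poly A p) e \<subseteq> (\<lambda>z. poly B z ^ 4 / poly A z) ` {z \<in> U. poly A z \<noteq> 0}"
proof -
  let ?f = "\<lambda>z. poly B z ^ 4 / poly A z"
  have "open (- {z. poly A z = 0})"
    by (intro open_Compl closed_Collect_eq continuous_intros)
  then have "open (U \<inter> - {z. poly A z = 0})" using U by blast
  moreover have "p \<in> U \<inter> - {z. poly A z = 0}" using p U by (auto simp: curve4_def)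
  ultimately obtain d where d: "0 < d" "ball p d \<subseteq> U \<inter> - {z. poly A z = 0}"
    by (meson openE)
  have "\<not> ?f constant_on ball p d"
  proof
    assume "?f constant_on ball p d"
    then have const: "?f z = ?f p" if "z \<in> ball p d" for z
      using that d(1) unfolding constant_on_def by (metis centre_in_ball)
    define c where "c = Re (?f p)"
    have c: "?f p = of_real c" "0 \<le> c" "c \<le> 4 ^ 4 / 3 ^ 3"
      using p by (auto simp: curve4_def c_def complex_eq_iff)
    have "B ^ 4 - smult (of_real c) A = 0"
    proof (rule ccontr)
      assume "B ^ 4 - smult (of_real c) A \<noteq> 0"
      then have "finite {z. poly (B ^ 4 - smult (of_real c) A) z = 0}"
        by (rule poly_roots_finite)
      moreover have "ball p d \<subseteq> {z. poly (B ^ 4 - smult (of_real c) A) z = 0}"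
      proof
        fix z assume z: "z \<in> ball p d"
        then have "poly A z \<noteq> 0" using d(2) by auto
        then show "z \<in> {z. poly (B ^ 4 - smult (of_real c) A) z = 0}"
          using const[OF z] c(1) by (simp add: field_simps poly_power)
      qed
      ultimately have "finite (ball p d)" by (rule rev_finite_subset)
      then show False using uncountable_ball[OF d(1), of p] countable_finite by blast
    qed
    moreover have "A \<noteq> 0" using p by (auto simp: curve4_def)
    ultimately show False using nd c unfolding degenerate4_def by auto
  qed
  then have "open (?f ` ball p d)"
    using d by (intro open_mapping_thm[of ?f "ball p d"] holomorphic_intros) auto
  moreover have "?f p \<in> ?f ` ball p d" using d by auto
  ultimately obtain e where "0 < e" "ball (?f p) e \<subseteq> ?f ` ball p d" by (meson openE)
  moreover have "ball p d \<subseteq> {z \<in> U. poly A z \<noteq> 0}" using d by auto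
  ultimately show ?thesis using that by (meson image_mono order.trans)
qed

theorem theorem5:
  fixes A B :: "complex poly" and H :: "nat \<Rightarrow> complex poly"
  assumes "has_genfun4 A B H"
  shows "(\<forall>m z. poly (H m) z = 0 \<and> poly A z \<noteq> 0 \<longrightarrow> z \<in> curve4 A B) \<and>
    (\<not> degenerate4 A B \<longrightarrow>
      (\<forall>p \<in> curve4 A B. \<forall>U. open U \<and> p \<in> U \<longrightarrow>
        (\<forall>\<^sub>F m in sequentially. \<exists>z \<in> U. poly (H m) z = 0 \<and> poly A z \<noteq> 0)))"
proof (intro conjI allI impI ballI)
  fix m z assume z: "poly (H m) z = 0 \<and> poly A z \<noteq> 0"
  show "z \<in> curve4 A B"
  proof (cases "poly B z = 0")
    case True
    then show ?thesis using z by (simp add: curve4_def)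
  next
    case False
    then have "poly (trinom_poly m) (poly A z / poly B z ^ 4) = 0"
      using z poly_H_eq[OF assms False, of m] by simp
    then obtain x where x: "poly A z / poly B z ^ 4 = of_real x" "27 / 256 < x"
      by (rule trinom_poly_roots)
    have "poly B z ^ 4 / poly A z = inverse (poly A z / poly B z ^ 4)" by simp
    also have "\<dots> = of_real (inverse x)" unfolding x(1) by (rule of_real_inverse[symmetric])
    finally have "poly B z ^ 4 / poly A z = of_real (inverse x)" .
    moreover have "0 \<le> inverse x" "inverse x \<le> 4 ^ 4 / 3 ^ 3"
      using x(2) le_imp_inverse_le[of "27 / 256" x] by simp_all
    ultimately show ?thesis using z
      by (simp only: curve4_def mem_Collect_eq Im_complex_of_real Re_complex_of_real) simp
  qed
next
  fix p U assume nd: "\<not> degenerate4 A B" and p: "p \<in> curve4 A B" and U: "open U \<and> p \<in> U"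
  obtain e where e: "0 < e"
    "ball (poly B p ^ 4 / poly A p) e \<subseteq> (\<lambda>z. poly B z ^ 4 / poly A z) ` {z \<in> U. poly A z \<noteq> 0}"
    by (rule quotient_image_open[OF nd p conjunct1[OF U] conjunct2[OF U]])
  define w where "w = Re (poly B p ^ 4 / poly A p)"
  have w: "poly B p ^ 4 / poly A p = of_real w" "0 \<le> w" "w \<le> 256 / 27"
    using p by (auto simp: curve4_def w_def complex_eq_iff)
  show "\<forall>\<^sub>F m in sequentially. \<exists>z \<in> U. poly (H m) z = 0 \<and> poly A z \<noteq> 0"
    using trinom_poly_roots_dense[OF w(2,3) e(1)]
  proof eventually_elim
    fix m assume "\<exists>x > 0. poly (trinom_poly m) x = 0 \<and> \<bar>1 / x - w\<bar> < e"
    then obtain x where x: "x > 0" "poly (trinom_poly m) x = 0" "\<bar>1 / x - w\<bar> < e" by blast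
    have "complex_of_real (1 / x) \<in> ball (poly B p ^ 4 / poly A p) e"
      unfolding w(1) using x(3) by (simp only: mem_ball dist_of_real dist_real_def abs_minus_commute)
    then have "complex_of_real (1 / x)
        \<in> (\<lambda>z. poly B z ^ 4 / poly A z) ` {z \<in> U. poly A z \<noteq> 0}"
      by (rule subsetD[OF e(2)])
    then obtain z where "z \<in> {z \<in> U. poly A z \<noteq> 0}"
      and z3: "of_real (1 / x) = poly B z ^ 4 / poly A z" by (rule imageE)
    then have z: "z \<in> U" "poly A z \<noteq> 0" "poly B z ^ 4 / poly A z = of_real (1 / x)"
      using z3[symmetric] by blast+
    have B: "poly B z \<noteq> 0"
    proof
      assume "poly B z = 0"
      then have "complex_of_real (1 / x) = 0" using z(3) by simp
      then show False using x(1) by simp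
    qed
    have "poly A z / poly B z ^ 4 = inverse (poly B z ^ 4 / poly A z)" by simp
    also have "\<dots> = of_real x" unfolding z(3) by simp
    finally have root: "poly A z / poly B z ^ 4 = of_real x" .
    have "poly (H m) z = 0"
      unfolding poly_H_eq[OF assms B] root poly_trinom_poly_of_real x(2) by simp
    then show "\<exists>z \<in> U. poly (H m) z = 0 \<and> poly A z \<noteq> 0" using z by blast
  qed
qed

end
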